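(* For every $X \in \mathfrak{J}(3,\mathfrak{C})$ there exist an element $\alpha \in F_4$ and real numbers $\xi_1, \xi_2, \xi_3 \in \mathbb{R}$ such that $$\alpha X = \begin{pmatrix} \xi_1 & 0 & 0 \\ 0 & \xi_2 & 0 \\ 0 & 0 & \xi_3 \end{pmatrix}.$$
   Context: Let $\mathbb{H}$ be the field of quaternions with its usual conjugation $m \mapsto \overline{m}$, and let $\mathfrak{C} = \mathbb{H} \oplus \mathbb{H}e_4$, $e_4^2 = -1$, be the division Cayley algebra (octonions) over $\mathbb{R}$, with multiplication $(m + a e_4)(n + b e_4) = (mn - \overline{b}a) + (a\overline{n} + bm)e_4$ and conjugation $\overline{m + a e_4} = \overline{m} - a e_4$ for $m,n,a,b \in \mathbb{H}$. Let $\mathfrak{J}(3,\mathfrak{C}) = \{X \in M(3,\mathfrak{C}) \mid X^* = X\}$, where $M(3,\mathfrak{C})$ is the set of $3\times 3$ matrices with entries in $\mathfrak{C}$ and $X^*$ is the conjugate transpose of $X$. This is a real vector space (of dimension 27) whose elements have the form $$X = \begin{pmatrix} \xi_1 & x_3 & \overline{x}_2 \\ \overline{x}_3 & \xi_2 & x_1 \\ x_2 & \overline{x}_1 & \xi_3 \end{pmatrix}, \quad \xi_i \in \mathbb{R},\ x_i \in \mathfrak{C}.$$ It is equipped with the Jordan multiplication $X \circ Y = \frac{1}{2}(XY + YX)$. Let $\mathrm{Iso}_{\mathbb{R}}(\mathfrak{J}(3,\mathfrak{C}))$ denote the group of $\mathbb{R}$-linear automorphisms of the real vector space $\mathfrak{J}(3,\mathfrak{C})$.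 The group $F_4$ is defined by $$F_4 = \{\alpha \in \mathrm{Iso}_{\mathbb{R}}(\mathfrak{J}(3,\mathfrak{C})) \mid \alpha(X \circ Y) = \alpha X \circ \alpha Y \text{ for all } X, Y \in \mathfrak{J}(3,\mathfrak{C})\}.$$ *)

theory Defs
  imports "HOL-Analysis.Analysis"
begin

section \<open>Quaternions\<close>

text \<open>\<open>Quat a b c d\<close> stands for \<open>a + b i + c j + d k\<close>.\<close>

datatype quat = Quat (q_re: real) (q_i: real) (q_j: real) (q_k: real)

lemma quat_eqI:
  "q_re x = q_re y \<Longrightarrow> q_i x = q_i y \<Longrightarrow> q_j x = q_j y \<Longrightarrow> q_k x = q_k y \<Longrightarrow> x = y"
  by (cases x; cases y) simp

instantiation quat :: real_algebra_1
begin

definition "0 = Quat 0 0 0 0"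
definition "1 = Quat 1 0 0 0"
definition "- x = Quat (- q_re x) (- q_i x) (- q_j x) (- q_k x)"
definition "x + y = Quat (q_re x + q_re y) (q_i x + q_i y) (q_j x + q_j y) (q_k x + q_k y)"
definition "x - y = Quat (q_re x - q_re y) (q_i x - q_i y) (q_j x - q_j y) (q_k x - q_k y)"
definition "r *\<^sub>R x = Quat (r * q_re x) (r * q_i x) (r * q_j x) (r * q_k x)"
definition "x * y = Quat
  (q_re x * q_re y - q_i x * q_i y - q_j x * q_j y - q_k x * q_k y)
  (q_re x * q_i y + q_i x * q_re y + q_j x * q_k y - q_k x * q_j y)
  (q_re x * q_j y - q_i x * q_k y + q_j x * q_re y + q_k x * q_i y)
  (q_re x * q_k y + q_i x * q_j y - q_j x * q_i y + q_k x * q_re y)"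

instance
  by standard
    (simp_all add: zero_quat_def one_quat_def uminus_quat_def plus_quat_def minus_quat_def
      scaleR_quat_def times_quat_def algebra_simps)

end

definition qcnj :: "quat \<Rightarrow> quat" where
  "qcnj x = Quat (q_re x) (- q_i x) (- q_j x) (- q_k x)"


section \<open>The division Cayley algebra\<close>

text \<open>\<open>Oct m a\<close> stands for \<open>m + a e\<^sub>4\<close>. Multiplication is not associative, so there is
  no ring instance and in particular no \<open>of_real\<close>; a real number \<open>\<xi>\<close> is regarded as the
  octonion \<open>\<xi> *\<^sub>R 1\<close>.\<close>

datatype octonion = Oct (o_fst: quat) (o_snd: quat)

instantiation octonion :: "{real_vector, one, times}"
begin

definition "0 = Oct 0 0"
definition "1 = Oct 1 0"
definition "- x = Oct (- o_fst x) (- o_snd x)"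
definition "x + y = Oct (o_fst x + o_fst y) (o_snd x + o_snd y)"
definition "x - y = Oct (o_fst x - o_fst y) (o_snd x - o_snd y)"
definition "r *\<^sub>R x = Oct (r *\<^sub>R o_fst x) (r *\<^sub>R o_snd x)"
definition "x * y = Oct
  (o_fst x * o_fst y - qcnj (o_snd y) * o_snd x)
  (o_snd x * qcnj (o_fst y) + o_snd y * o_fst x)"

instance
  by standard
    (simp_all add: zero_octonion_def uminus_octonion_def plus_octonion_def
      minus_octonion_def scaleR_octonion_def algebra_simps)

end

definition ocnj :: "octonion \<Rightarrow> octonion" where
  "ocnj x = Oct (qcnj (o_fst x)) (- o_snd x)"

lemma Oct_times_Oct:
  "Oct m a * Oct n b = Oct (m * n - qcnj b * a) (a * qcnj n + b * m)"
  by (simp add: times_octonion_def)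

lemma qcnj_linear [simp]:
  "qcnj 0 = 0" "qcnj (x + y) = qcnj x + qcnj y" "qcnj (x - y) = qcnj x - qcnj y"
  "qcnj (- x) = - qcnj x" "qcnj (r *\<^sub>R x) = r *\<^sub>R qcnj x"
  by (simp_all add: qcnj_def zero_quat_def plus_quat_def minus_quat_def uminus_quat_def
      scaleR_quat_def)

lemma qcnj_mult: "qcnj (x * y) = qcnj y * qcnj x"
  by (simp add: qcnj_def times_quat_def algebra_simps)

lemma qcnj_qcnj [simp]: "qcnj (qcnj x) = x"
  by (simp add: qcnj_def)

lemma ocnj_linear [simp]:
  "ocnj 0 = 0" "ocnj (x + y) = ocnj x + ocnj y" "ocnj (x - y) = ocnj x - ocnj y"
  "ocnj (- x) = - ocnj x" "ocnj (r *\<^sub>R x) = r *\<^sub>R ocnj x"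
  by (simp_all add: ocnj_def zero_octonion_def plus_octonion_def minus_octonion_def
      uminus_octonion_def scaleR_octonion_def)

lemma ocnj_mult: "ocnj (x * y) = ocnj y * ocnj x"
  by (simp add: ocnj_def times_octonion_def qcnj_mult)

lemma ocnj_sum: "ocnj (sum f A) = (\<Sum>i\<in>A. ocnj (f i))"
  by (induction A rule: infinite_finite_induct) simp_all


section \<open>The exceptional Jordan algebra\<close>

text \<open>The library product \<open>**\<close> requires entries in a semiring, which excludes octonions.\<close>

definition omat_mult :: "octonion^3^3 \<Rightarrow> octonion^3^3 \<Rightarrow> octonion^3^3"  (infixl \<open>\<bullet>\<bullet>\<close> 70) where
  "X \<bullet>\<bullet> Y = (\<chi> i j. \<Sum>k\<in>UNIV. X $ i $ k * Y $ k $ j)"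

definition omat_adj :: "octonion^3^3 \<Rightarrow> octonion^3^3" where
  "omat_adj X = (\<chi> i j. ocnj (X $ j $ i))"

lemma omat_adj_linear:
  "omat_adj 0 = 0" "omat_adj (X + Y) = omat_adj X + omat_adj Y"
  "omat_adj (X - Y) = omat_adj X - omat_adj Y" "omat_adj (- X) = - omat_adj X"
  "omat_adj (r *\<^sub>R X) = r *\<^sub>R omat_adj X"
  by (simp_all add: omat_adj_def vec_eq_iff)

lemma omat_adj_mult: "omat_adj (X \<bullet>\<bullet> Y) = omat_adj Y \<bullet>\<bullet> omat_adj X"
  by (simp add: omat_adj_def omat_mult_def vec_eq_iff ocnj_sum ocnj_mult)

typedef jordan3 = "{X :: octonion^3^3. omat_adj X = X}"
  morphisms mat_of Abs_jordan3
  by (intro exI[of _ 0]) (simp add: omat_adj_linear)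

setup_lifting type_definition_jordan3

instantiation jordan3 :: real_vector
begin

lift_definition zero_jordan3 :: jordan3 is 0 by (simp add: omat_adj_linear)
lift_definition uminus_jordan3 :: "jordan3 \<Rightarrow> jordan3" is uminus by (simp add: omat_adj_linear)
lift_definition plus_jordan3 :: "jordan3 \<Rightarrow> jordan3 \<Rightarrow> jordan3" is "(+)"
  by (simp add: omat_adj_linear)
lift_definition minus_jordan3 :: "jordan3 \<Rightarrow> jordan3 \<Rightarrow> jordan3" is "(-)"
  by (simp add: omat_adj_linear)
lift_definition scaleR_jordan3 :: "real \<Rightarrow> jordan3 \<Rightarrow> jordan3" is scaleR
  by (simp add: omat_adj_linear)

instance
  by standard (transfer; simp add: algebra_simps)+

end

lift_definition jordan_mult :: "jordan3 \<Rightarrow> jordan3 \<Rightarrow> jordan3"  (infixl \<open>\<odot>\<close> 70)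
  is "\<lambda>X Y. (1 / 2) *\<^sub>R (X \<bullet>\<bullet> Y + Y \<bullet>\<bullet> X)"
  by (simp add: omat_adj_linear omat_adj_mult add.commute)


section \<open>The group \<open>F\<^sub>4\<close>\<close>

definition Iso_R :: "('a::real_vector \<Rightarrow> 'a) set" where
  "Iso_R = {\<alpha>. linear \<alpha> \<and> bij \<alpha>}"

definition F4 :: "(jordan3 \<Rightarrow> jordan3) set" where
  "F4 = {\<alpha> \<in> Iso_R. \<forall>X Y. \<alpha> (X \<odot> Y) = \<alpha> X \<odot> \<alpha> Y}"

end

theory Submission
  imports Defs
begin

text \<open>
  Two families of automorphisms suffice, and finitely many of them diagonalize a given matrix.

  Conjugation by a real orthogonal matrix is an automorphism because real numbers associate with
  octonions (\<open>real_conjugate_in_F4\<close>). A unit octonion \<open>a\<close> acts on the three off-diagonal octonions by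
  \<open>(x\<^sub>1, x\<^sub>2, x\<^sub>3) \<mapsto> (a x\<^sub>1 a, ocnj a x\<^sub>2, x\<^sub>3 ocnj a)\<close> and fixes the diagonal. This is an automorphism by
  the Moufang identity (\<open>triality_unit\<close>, \<open>diagonal_action_in_F4\<close>), and so are its two cyclic shifts.

  Let \<open>X\<close> have off-diagonal octonions \<open>x\<^sub>1, x\<^sub>2, x\<^sub>3\<close>. The entries \<open>x\<^sub>3\<close> and \<open>ocnj x\<^sub>2\<close> of the first row
  are multiplied from the right by \<open>ocnj u\<close> and \<open>u\<close> under the action of a unit \<open>u\<close>, and a suitable
  square root \<open>u\<close> makes them real multiples of one octonion (\<open>exists_unit_making_parallel\<close>). A real
  orthogonal transformation of the last two indices then removes \<open>x\<^sub>2\<close>, as in Householder's reduction to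
  tridiagonal form (\<open>diagonalizable_parallel\<close>). Another unit makes \<open>x\<^sub>3\<close> real. Combining the actions in
  two positions gives automorphisms that fix a real \<open>x\<^sub>3\<close> and multiply \<open>x\<^sub>1\<close> by an imaginary unit
  (\<open>diagonalizable_twist\<close>); two of them make \<open>x\<^sub>1\<close> real, the first by making it imaginary and the second by
  rotating it onto the real axis. The matrix is now real symmetric, and the real spectral theorem
  (\<open>symmetric_matrix_diagonalizable\<close>) finishes the argument.
\<close>

section \<open>Octonion arithmetic\<close>

definition o_re :: "octonion \<Rightarrow> real" where
  "o_re x = q_re (o_fst x)"

text \<open>The Euclidean inner product of the eight real coordinates. Written through the real part,
  it inherits the associativity and commutativity that the real part of a product has.\<close>

definition oinner :: "octonion \<Rightarrow> octonion \<Rightarrow> real" where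
  "oinner x y = o_re (x * ocnj y)"

lemmas quat_coords = zero_quat_def one_quat_def uminus_quat_def plus_quat_def minus_quat_def
  scaleR_quat_def times_quat_def qcnj_def

lemmas oct_coords = zero_octonion_def one_octonion_def uminus_octonion_def plus_octonion_def
  minus_octonion_def scaleR_octonion_def times_octonion_def ocnj_def

lemma qcnj_one [simp]: "qcnj 1 = 1"
  by (simp add: quat_coords)

lemma oct_distrib:
  fixes x y z :: octonion
  shows "(x + y) * z = x * z + y * z" "x * (y + z) = x * y + x * z"
    "(x - y) * z = x * z - y * z" "x * (y - z) = x * y - x * z"
  by (simp_all add: oct_coords algebra_simps)

lemma oct_mult_simps [simp]:
  fixes x y :: octonion
  shows "- x * y = - (x * y)" "x * - y = - (x * y)"
    "(r *\<^sub>R x) * y = r *\<^sub>R (x * y)" "x * (r *\<^sub>R y) = r *\<^sub>R (x * y)"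
    "0 * x = 0" "x * 0 = 0" "1 * x = x" "x * 1 = x"
  by (simp_all add: oct_coords algebra_simps)

lemma ocnj_simps [simp]: "ocnj (ocnj x) = x" "ocnj 1 = 1"
  by (simp_all add: oct_coords)

lemma o_re_linear [simp]:
  "o_re 0 = 0" "o_re 1 = 1" "o_re (x + y) = o_re x + o_re y" "o_re (x - y) = o_re x - o_re y"
  "o_re (- x) = - o_re x" "o_re (r *\<^sub>R x) = r * o_re x" "o_re (ocnj x) = o_re x"
  by (simp_all add: o_re_def oct_coords quat_coords)

text \<open>The real part of a product of octonions neither depends on the cyclic order of the factors
  nor on the bracketing. These two identities replace associativity in what follows.\<close>

lemma o_re_commute: "o_re (x * y) = o_re (y * x)"
  by (simp add: o_re_def oct_coords quat_coords algebra_simps)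

lemma o_re_assoc: "o_re ((x * y) * z) = o_re (x * (y * z))"
  by (simp add: o_re_def oct_coords quat_coords algebra_simps)

lemma oct_left_alternative:
  fixes x y :: octonion
  shows "x * (x * y) = (x * x) * y"
  by (simp add: oct_coords quat_coords algebra_simps)

lemma oct_flexible:
  fixes x y :: octonion
  shows "(x * y) * x = x * (y * x)"
  by (simp add: oct_coords quat_coords algebra_simps)

text \<open>Conjugation differs from negation by a real multiple of \<open>1\<close>, and real multiples of \<open>1\<close>
  associate with everything. Hence the alternative laws also hold with one of the two equal factors conjugated.\<close>

lemma ocnj_eq: "ocnj x = (2 * o_re x) *\<^sub>R 1 - x"
  by (simp add: o_re_def oct_coords quat_coords algebra_simps)

lemma ocnj_mult_self: "ocnj x * x = oinner x x *\<^sub>R 1"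
  by (simp add: oinner_def o_re_def oct_coords quat_coords algebra_simps)

lemma oinner_linear [simp]:
  "oinner 0 z = 0" "oinner (x + y) z = oinner x z + oinner y z" 
  "oinner (x - y) z = oinner x z - oinner y z"
  "oinner (- x) z = - oinner x z" "oinner (r *\<^sub>R x) z = r * oinner x z"
  by (simp_all add: oinner_def oct_distrib)

lemma oinner_commute: "oinner x y = oinner y x"
  by (metis oinner_def ocnj_mult ocnj_simps(1) o_re_linear(7))

lemma oinner_scaleR_right [simp]: "oinner z (r *\<^sub>R x) = r * oinner z x"
  by (simp add: oinner_commute[of z])

lemma oinner_ocnj [simp]: "oinner (ocnj x) (ocnj y) = oinner x y"
  by (metis oinner_def oinner_commute o_re_commute ocnj_simps(1))

lemma oinner_self:
  "oinner x x = (((q_re (o_fst x))\<^sup>2 + (q_i (o_fst x))\<^sup>2) + ((q_j (o_fst x))\<^sup>2 + (q_k (o_fst x))\<^sup>2))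
    + (((q_re (o_snd x))\<^sup>2 + (q_i (o_snd x))\<^sup>2) + ((q_j (o_snd x))\<^sup>2 + (q_k (o_snd x))\<^sup>2))"
  by (simp add: oinner_def o_re_def oct_coords quat_coords power2_eq_square)

lemma oinner_self_nonneg: "oinner x x \<ge> 0"
  unfolding oinner_self by (intro add_nonneg_nonneg zero_le_power2)

lemma oinner_eq_0_iff [simp]: "oinner x x = 0 \<longleftrightarrow> x = 0"
proof
  assume "oinner x x = 0"
  then have "o_fst x = 0 \<and> o_snd x = 0"
    unfolding oinner_self by (simp add: add_nonneg_eq_0_iff quat_coords quat.expand)
  then show "x = 0"
    by (simp add: oct_coords octonion.expand)
qed simp

lemma oct_right_alternative:
  fixes x y :: octonion
  shows "(y * x) * x = y * (x * x)"
  by (simp add: oct_coords quat_coords algebra_simps)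

lemma ocnj_mult_cancel: "ocnj a * (a * y) = oinner a a *\<^sub>R y"
proof -
  have "ocnj a * (a * y) = (ocnj a * a) * y"
    by (simp add: ocnj_eq oct_distrib oct_left_alternative)
  then show ?thesis by (simp add: ocnj_mult_self)
qed

lemma mult_ocnj_cancel: "a * (ocnj a * y) = oinner a a *\<^sub>R y"
  using ocnj_mult_cancel[of "ocnj a" y] by simp

lemma mult_ocnj_cancel_right: "(y * a) * ocnj a = oinner a a *\<^sub>R y" "(y * ocnj a) * a = oinner a a *\<^sub>R y"
  by (metis ocnj_mult ocnj_mult_cancel mult_ocnj_cancel ocnj_simps(1) ocnj_linear(5))+

text \<open>A factor \<open>u\<close> common to both arguments can be moved next to its conjugate inside the real part
  and then cancelled. For \<open>x = y\<close> this is the multiplicativity of the norm.\<close>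

lemma oinner_mult_left: "oinner (u * x) (u * y) = oinner u u * oinner x y"
proof -
  have "oinner (u * x) (u * y) = o_re ((u * x) * (ocnj y * ocnj u))"
    by (simp add: oinner_def ocnj_mult)
  also have "\<dots> = o_re (ocnj u * ((u * x) * ocnj y))"
    by (metis o_re_assoc o_re_commute)
  also have "\<dots> = o_re ((ocnj u * (u * x)) * ocnj y)"
    by (simp add: o_re_assoc)
  finally show ?thesis by (simp add: ocnj_mult_cancel oinner_def)
qed

lemma oinner_mult_right: "oinner (x * u) (y * u) = oinner u u * oinner x y"
  using oinner_mult_left[of "ocnj u" "ocnj x" "ocnj y"] oinner_ocnj[of "x * u" "y * u"]
  by (simp add: ocnj_mult)

text \<open>The left alternative law says that left multiplication \<open>L\<close> respects squares, hence by
  polarization \<open>L (u v + v u) = L u L v + L v L u\<close>. The element \<open>a x a\<close> is a combination of such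
  anticommutators, \<open>2 a x a = {a, {a, x}} - {a\<^sup>2, x}\<close>, so that \<open>L\<close> respects it as well:
  \<open>L (a x a) = L a L x L a\<close>.\<close>

lemma oct_left_moufang:
  fixes a x y :: octonion
  shows "(a * (x * a)) * y = a * (x * (a * y))"
proof -
  have lin: "(u * v + v * u) * w = u * (v * w) + v * (u * w)" for u v w :: octonion
    using oct_left_alternative[of "u + v" w] oct_left_alternative[of u w] oct_left_alternative[of v w]
    by (simp add: oct_distrib algebra_simps)
  let ?b = "a * x + x * a"
  have "(a * ?b + ?b * a) - ((a * a) * x + x * (a * a)) = 2 *\<^sub>R (a * (x * a))"
    by (simp add: oct_distrib oct_left_alternative oct_right_alternative oct_flexible scaleR_2)
  then have "2 *\<^sub>R ((a * (x * a)) * y) = ((a * ?b + ?b * a) - ((a * a) * x + x * (a * a))) * y"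
    by simp
  also have "\<dots> = (a * (?b * y) + ?b * (a * y)) - ((a * a) * (x * y) + x * ((a * a) * y))"
    by (simp only: oct_distrib(3) lin[of a ?b y] lin[of "a * a" x y])
  also have "\<dots> = 2 *\<^sub>R (a * (x * (a * y)))"
    unfolding lin by (simp add: oct_distrib(2) oct_left_alternative[symmetric] scaleR_2)
  finally show ?thesis by simp
qed

section \<open>Coordinates on the Jordan algebra\<close>

text \<open>The octonion \<open>x\<^sub>i\<close> and its conjugate stand in the rows and columns other than \<open>i\<close>. Which of the
  two positions gets the conjugate is chosen such that the cyclic shift of the indices permutes
  the coordinates.\<close>

lift_definition herm ::
  "real \<Rightarrow> real \<Rightarrow> real \<Rightarrow> octonion \<Rightarrow> octonion \<Rightarrow> octonion \<Rightarrow> jordan3" is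
  "\<lambda>\<xi>1 \<xi>2 \<xi>3 x1 x2 x3.
    vector [vector [\<xi>1 *\<^sub>R 1, x3, ocnj x2],
            vector [ocnj x3, \<xi>2 *\<^sub>R 1, x1],
            vector [x2, ocnj x1, \<xi>3 *\<^sub>R 1]]"
  by (simp add: omat_adj_def vec_eq_iff forall_3)

lemma ocnj_fixed_imp_real:
  assumes "ocnj x = x"
  shows "x = o_re x *\<^sub>R 1"
proof -
  have "2 *\<^sub>R x = ocnj x + x" using assms by (simp add: scaleR_2)
  also have "\<dots> = 2 *\<^sub>R (o_re x *\<^sub>R 1)" by (simp add: ocnj_eq)
  finally show ?thesis by (metis scaleR_cancel_left zero_neq_numeral)
qed

lemma herm_cases:
  obtains \<xi>1 \<xi>2 \<xi>3 x1 x2 x3 where "X = herm \<xi>1 \<xi>2 \<xi>3 x1 x2 x3"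
proof
  let ?M = "mat_of X"
  have adj: "ocnj (?M $ j $ i) = ?M $ i $ j" for i j
    using mat_of[of X] by (simp add: omat_adj_def vec_eq_iff)
  have "?M $ i $ i = o_re (?M $ i $ i) *\<^sub>R 1" for i
    by (rule ocnj_fixed_imp_real) (rule adj)
  then show "X = herm (o_re (?M $ 1 $ 1)) (o_re (?M $ 2 $ 2)) (o_re (?M $ 3 $ 3))
      (?M $ 2 $ 3) (?M $ 3 $ 1) (?M $ 1 $ 2)"
    by (simp add: mat_of_inject[symmetric] herm.rep_eq vec_eq_iff forall_3 adj)
qed

lemma herm_add:
  "herm a b c x y z + herm a' b' c' x' y' z' = herm (a + a') (b + b') (c + c') (x + x') (y + y') (z + z')"
  by (simp add: mat_of_inject[symmetric] herm.rep_eq plus_jordan3.rep_eq vec_eq_iff forall_3 algebra_simps)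

lemma herm_scaleR:
  "r *\<^sub>R herm a b c x y z = herm (r * a) (r * b) (r * c) (r *\<^sub>R x) (r *\<^sub>R y) (r *\<^sub>R z)"
  by (simp add: mat_of_inject[symmetric] herm.rep_eq scaleR_jordan3.rep_eq vec_eq_iff forall_3)

lemma mult_ocnj_add: "x * ocnj y + y * ocnj x = (2 * oinner x y) *\<^sub>R 1"
  by (simp add: oinner_def o_re_def oct_coords quat_coords algebra_simps)

lemma ocnj_mult_add: "ocnj x * y + ocnj y * x = (2 * oinner x y) *\<^sub>R 1"
  using mult_ocnj_add[of "ocnj x" "ocnj y"] by simp

text \<open>Each off-diagonal coordinate of a product contains \<open>ocnj (x\<^sub>j * y\<^sub>k)\<close> with \<open>(i, j, k)\<close> cyclic, and
  the diagonal coordinates contain only inner products. A map acting separately on the three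
  octonions by linear maps is therefore multiplicative as soon as it respects these two kinds of terms.\<close>

lemma jordan_mult_herm:
  "herm a b c x y z \<odot> herm a' b' c' x' y' z' =
    herm (a * a' + oinner y y' + oinner z z')
         (b * b' + oinner z z' + oinner x x')
         (c * c' + oinner x x' + oinner y y')
         ((1 / 2) *\<^sub>R ((b + c) *\<^sub>R x' + (b' + c') *\<^sub>R x + ocnj (y * z' + y' * z)))
         ((1 / 2) *\<^sub>R ((c + a) *\<^sub>R y' + (c' + a') *\<^sub>R y + ocnj (z * x' + z' * x)))
         ((1 / 2) *\<^sub>R ((a + b) *\<^sub>R z' + (a' + b') *\<^sub>R z + ocnj (x * y' + x' * y)))"
proof -
  have flip: "v * ocnj u = (2 * oinner u v) *\<^sub>R 1 - u * ocnj v"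
    "ocnj v * u = (2 * oinner u v) *\<^sub>R 1 - ocnj u * v" for u v
    using mult_ocnj_add[of u v] ocnj_mult_add[of u v] by (simp_all add: algebra_simps)
  have half: "(r / 2) *\<^sub>R u + (r / 2) *\<^sub>R u = r *\<^sub>R u" for r and u :: octonion
    by (simp flip: scaleR_add_left)
  \<comment> \<open>The symmetrized diagonal entries are real because the two orders of a product with a
    conjugate are conjugates of each other; only one of the two orders is kept.\<close>
  note flips = flip[of x' x] flip[of y' y] flip[of z' z]
  show ?thesis
    by (simp add: mat_of_inject[symmetric] herm.rep_eq jordan_mult.rep_eq omat_mult_def
       vec_eq_iff forall_3 sum_3 flips ocnj_mult oinner_commute[of x'] oinner_commute[of y']
       oinner_commute[of z'])
      (simp add: algebra_simps half)
qed

section \<open>Triality\<close>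

text \<open>Compatibility is required of the trilinear form \<open>o_re ((x * y) * z)\<close> and not of the product,
  since the form is invariant under cyclic shifts and the condition is then so as well.\<close>

definition triality ::
  "(octonion \<Rightarrow> octonion) \<Rightarrow> (octonion \<Rightarrow> octonion) \<Rightarrow> (octonion \<Rightarrow> octonion) \<Rightarrow> bool" where
  "triality f g h \<longleftrightarrow>
    (\<forall>k\<in>{f, g, h}. linear k \<and> surj k \<and> (\<forall>x y. oinner (k x) (k y) = oinner x y)) \<and>
    (\<forall>x y z. o_re ((f x * g y) * h z) = o_re ((x * y) * z))"

lemma triality_rotate: "triality f g h \<Longrightarrow> triality g h f"
  unfolding triality_def by (auto simp: o_re_assoc) (metis o_re_assoc o_re_commute)

text \<open>Pairing with an arbitrary \<open>h w\<close> turns the trilinear identity into an identity of inner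
  products, and \<open>h\<close> is a surjective isometry.\<close>

lemma triality_mult:
  assumes "triality f g h"
  shows "ocnj (f x * g y) = h (ocnj (x * y))"
proof -
  have iso: "\<And>u v. oinner (h u) (h v) = oinner u v"
    using assms by (auto simp: triality_def)
  have "surj h" using assms by (simp add: triality_def)
  then obtain z where z: "ocnj (f x * g y) = h z" by (rule surjE)
  have pair: "oinner (ocnj (f x * g y)) (h w) = oinner (ocnj (x * y)) w" for w
  proof -
    have "o_re ((f x * g y) * h w) = o_re ((x * y) * w)"
      using assms by (simp add: triality_def)
    moreover have "oinner (ocnj u) v = o_re (u * v)" for u v
      using oinner_ocnj[of u "ocnj v"] by (simp add: oinner_def)
    ultimately show ?thesis by simp
  qed
  let ?w = "z - ocnj (x * y)"
  have "oinner ?w ?w = 0"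
    using pair[of ?w] by (simp add: z iso)
  then have "?w = 0" by (simp only: oinner_eq_0_iff)
  then show ?thesis using z by simp
qed

definition diagonal_action ::
  "(octonion \<Rightarrow> octonion) \<Rightarrow> (octonion \<Rightarrow> octonion) \<Rightarrow> (octonion \<Rightarrow> octonion) \<Rightarrow> jordan3 \<Rightarrow> jordan3" where
  "diagonal_action f g h X = (let M = mat_of X in
    herm (o_re (M $ 1 $ 1)) (o_re (M $ 2 $ 2)) (o_re (M $ 3 $ 3))
      (f (M $ 2 $ 3)) (g (M $ 3 $ 1)) (h (M $ 1 $ 2)))"

lemma diagonal_action_herm [simp]:
  "diagonal_action f g h (herm a b c x y z) = herm a b c (f x) (g y) (h z)"
  by (simp add: diagonal_action_def herm.rep_eq)

text \<open>By cyclic symmetry the product rule of \<open>triality_mult\<close> holds in all three positions, which is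
  what the coordinate formula for the Jordan product asks for.\<close>

lemma diagonal_action_in_F4:
  assumes "triality f g h"
  shows "diagonal_action f g h \<in> F4"
proof -
  let ?D = "diagonal_action f g h"
  have lin: "linear f" "linear g" "linear h" and surj: "surj f" "surj g" "surj h"
    and iso: "\<And>x y. oinner (f x) (f y) = oinner x y" "\<And>x y. oinner (g x) (g y) = oinner x y"
      "\<And>x y. oinner (h x) (h y) = oinner x y"
    using assms by (auto simp: triality_def)
  have inj: "inj f" "inj g" "inj h"
    using lin iso by (simp_all add: linear_injective_0) (metis oinner_eq_0_iff)+
  note add = lin[THEN linear_add] and scale = lin[THEN linear_scale]
  have mult: "ocnj (f x * g y) = h (ocnj (x * y))" "ocnj (g x * h y) = f (ocnj (x * y))"
    "ocnj (h x * f y) = g (ocnj (x * y))" for x y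
    using triality_mult[OF assms] triality_mult[OF triality_rotate[OF assms]]
      triality_mult[OF triality_rotate[OF triality_rotate[OF assms]]] by auto
  have "linear ?D"
  proof
    fix X Y r
    obtain a b c x y z where X: "X = herm a b c x y z" by (rule herm_cases)
    obtain a' b' c' x' y' z' where Y: "Y = herm a' b' c' x' y' z'" by (rule herm_cases)
    show "?D (X + Y) = ?D X + ?D Y"
      by (simp add: X Y herm_add add)
    show "?D (r *\<^sub>R X) = r *\<^sub>R ?D X"
      by (simp add: X herm_scaleR scale)
  qed
  moreover have "bij ?D"
  proof (rule o_bij)
    show "diagonal_action (inv f) (inv g) (inv h) \<circ> ?D = id"
    proof
      fix X show "(diagonal_action (inv f) (inv g) (inv h) \<circ> ?D) X = id X"
        by (cases X rule: herm_cases) (simp add: inj)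
    qed
    show "?D \<circ> diagonal_action (inv f) (inv g) (inv h) = id"
    proof
      fix X show "(?D \<circ> diagonal_action (inv f) (inv g) (inv h)) X = id X"
        by (cases X rule: herm_cases) (simp add: surj surj_f_inv_f)
    qed
  qed
  moreover have "?D (X \<odot> Y) = ?D X \<odot> ?D Y" for X Y
  proof -
    obtain a b c x y z where X: "X = herm a b c x y z" by (rule herm_cases)
    obtain a' b' c' x' y' z' where Y: "Y = herm a' b' c' x' y' z'" by (rule herm_cases)
    show ?thesis
      by (simp add: X Y jordan_mult_herm iso mult add scale)
  qed
  ultimately show ?thesis
    by (simp add: F4_def Iso_R_def)
qed

text \<open>This is the left Moufang identity: with \<open>a\<close> a unit it reads \<open>(a x a) (ocnj a y) = a (x y)\<close>, and the
  remaining \<open>a\<close> cancels under the real part against the factor \<open>ocnj a\<close> of the third map.\<close>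

lemma triality_unit:
  assumes "oinner a a = 1"
  shows "triality (\<lambda>x. a * (x * a)) (\<lambda>x. ocnj a * x) (\<lambda>x. x * ocnj a)"
proof -
  have c: "ocnj a * (a * x) = x" "a * (ocnj a * x) = x" "(x * a) * ocnj a = x" "(x * ocnj a) * a = x" for x
    using assms by (simp_all add: ocnj_mult_cancel mult_ocnj_cancel mult_ocnj_cancel_right)
  show ?thesis
    unfolding triality_def
  proof (intro conjI ballI allI)
    fix k assume k: "k \<in> {\<lambda>x. a * (x * a), \<lambda>x. ocnj a * x, \<lambda>x. x * ocnj a}"
    show "linear k"
      using k by (auto intro!: linearI simp: oct_distrib)
    have "surj (\<lambda>x. a * (x * a))"
      by (rule surjI[of _ "\<lambda>x. (ocnj a * x) * ocnj a"]) (simp add: c)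
    moreover have "surj (\<lambda>x. ocnj a * x)"
      by (rule surjI[of _ "\<lambda>x. a * x"]) (simp add: c)
    moreover have "surj (\<lambda>x. x * ocnj a)"
      by (rule surjI[of _ "\<lambda>x. x * a"]) (simp add: c)
    ultimately show "surj k" using k by auto
    show "oinner (k x) (k y) = oinner x y" for x y
      using k by (elim insertE emptyE) (simp_all only: oinner_mult_left oinner_mult_right oinner_ocnj assms mult_1)
  next
    fix x y z
    have "(a * (x * a)) * (ocnj a * y) = a * (x * y)"
      by (simp add: oct_left_moufang c)
    then have "o_re (((a * (x * a)) * (ocnj a * y)) * (z * ocnj a)) = o_re ((a * (x * y)) * (z * ocnj a))"
      by simp
    also have "\<dots> = o_re ((z * ocnj a) * (a * (x * y)))"
      by (rule o_re_commute)
    also have "\<dots> = o_re (z * (x * y))"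
      by (simp add: o_re_assoc c)
    also have "\<dots> = o_re ((x * y) * z)"
      by (rule o_re_commute)
    finally show "o_re (((a * (x * a)) * (ocnj a * y)) * (z * ocnj a)) = o_re ((x * y) * z)" .
  qed
qed

section \<open>Conjugation by real orthogonal matrices\<close>

text \<open>Real numbers commute and associate with octonions, so multiplication by real matrices obeys the
  usual associative laws although octonion matrices do not. Conjugation is split into a left and a
  right factor, each of which passes through the octonionic product separately.\<close>

definition real_lmult :: "real^3^3 \<Rightarrow> octonion^3^3 \<Rightarrow> octonion^3^3" where
  "real_lmult P X = (\<chi> i j. \<Sum>k\<in>UNIV. P $ i $ k *\<^sub>R X $ k $ j)"

definition real_rmult_transpose :: "real^3^3 \<Rightarrow> octonion^3^3 \<Rightarrow> octonion^3^3" where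
  "real_rmult_transpose P X = (\<chi> i j. \<Sum>k\<in>UNIV. P $ j $ k *\<^sub>R X $ i $ k)"

lemma real_mult_linear:
  "real_lmult P (X + Y) = real_lmult P X + real_lmult P Y"
  "real_lmult P (r *\<^sub>R X) = r *\<^sub>R real_lmult P X"
  "real_rmult_transpose P (X + Y) = real_rmult_transpose P X + real_rmult_transpose P Y"
  "real_rmult_transpose P (r *\<^sub>R X) = r *\<^sub>R real_rmult_transpose P X"
  by (simp_all add: real_lmult_def real_rmult_transpose_def vec_eq_iff scaleR_add_right sum.distrib
      scaleR_sum_right mult.commute)

lemma omat_adj_real_lmult: "omat_adj (real_lmult P X) = real_rmult_transpose P (omat_adj X)"
  and omat_adj_real_rmult: "omat_adj (real_rmult_transpose P X) = real_lmult P (omat_adj X)"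
  by (simp_all add: omat_adj_def real_lmult_def real_rmult_transpose_def vec_eq_iff ocnj_sum)

lemma real_lmult_rmult:
  "real_lmult P (real_rmult_transpose Q X) = real_rmult_transpose Q (real_lmult P X)"
  by (simp add: real_lmult_def real_rmult_transpose_def vec_eq_iff sum_3 algebra_simps)

lemma real_lmult_lmult: "real_lmult P (real_lmult Q X) = real_lmult (P ** Q) X"
  by (simp add: real_lmult_def vec_eq_iff sum_3 matrix_matrix_mult_def algebra_simps)

lemma real_lmult_one: "real_lmult (mat 1) X = X"
  by (simp add: real_lmult_def vec_eq_iff forall_3 sum_3 mat_def)

lemma real_lmult_mult: "real_lmult P X \<bullet>\<bullet> Y = real_lmult P (X \<bullet>\<bullet> Y)"
  by (simp add: omat_mult_def real_lmult_def vec_eq_iff sum_3 oct_distrib algebra_simps)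

lemma mult_real_rmult:
  "X \<bullet>\<bullet> real_rmult_transpose P Y = real_rmult_transpose P (X \<bullet>\<bullet> Y)"
  by (simp add: omat_mult_def real_rmult_transpose_def vec_eq_iff sum_3 oct_distrib algebra_simps)

lemma real_mult_shift:
  "real_rmult_transpose P X \<bullet>\<bullet> Y = X \<bullet>\<bullet> real_lmult (transpose P) Y"
  by (simp add: omat_mult_def real_lmult_def real_rmult_transpose_def transpose_def vec_eq_iff sum_3
      oct_distrib algebra_simps)

lift_definition real_conjugate :: "real^3^3 \<Rightarrow> jordan3 \<Rightarrow> jordan3" is
  "\<lambda>P X. real_lmult P (real_rmult_transpose P X)"
  by (simp add: omat_adj_real_lmult omat_adj_real_rmult real_lmult_rmult)

lemma real_conjugate_entry:
  "mat_of (real_conjugate P X) $ i $ j =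
    (\<Sum>k\<in>UNIV. P $ i $ k *\<^sub>R (\<Sum>l\<in>UNIV. P $ j $ l *\<^sub>R mat_of X $ k $ l))"
  by (simp add: real_conjugate.rep_eq real_lmult_def real_rmult_transpose_def)

lemma real_rmult_inverse:
  assumes "Q ** P = mat 1"
  shows "real_rmult_transpose Q (real_rmult_transpose P X) = X"
proof -
  have "omat_adj (real_rmult_transpose Q (real_rmult_transpose P X)) = omat_adj X"
    by (simp add: omat_adj_real_rmult real_lmult_lmult assms real_lmult_one)
  then show ?thesis
    by (metis (no_types) omat_adj_def ocnj_simps(1) vec_eq_iff vec_lambda_beta)
qed

lemma real_conjugate_inverse:
  assumes "Q ** P = mat 1"
  shows "real_conjugate Q (real_conjugate P X) = X"
  using assms
  by transfer (simp add: real_lmult_rmult[symmetric] real_rmult_inverse real_lmult_lmult real_lmult_one)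

text \<open>In the product of two conjugates the adjacent factors \<open>transpose P\<close> and \<open>P\<close> meet and cancel.\<close>

lemma real_conjugate_in_F4:
  assumes "orthogonal_matrix P"
  shows "real_conjugate P \<in> F4"
proof -
  have P: "transpose P ** P = mat 1" "P ** transpose P = mat 1"
    using assms by (simp_all add: orthogonal_matrix_def)
  have "linear (real_conjugate P)"
    by (rule linearI; transfer) (simp_all add: real_mult_linear)
  moreover have "bij (real_conjugate P)"
    by (rule o_bij[of "real_conjugate (transpose P)"]) (simp_all add: fun_eq_iff real_conjugate_inverse P)
  moreover have "real_conjugate P (X \<odot> Y) = real_conjugate P X \<odot> real_conjugate P Y" for X Y
  proof -
    have "real_lmult P (real_rmult_transpose P M) \<bullet>\<bullet> real_lmult P (real_rmult_transpose P N) =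
        real_lmult P (real_rmult_transpose P (M \<bullet>\<bullet> N))" for M N
      by (simp add: real_lmult_mult mult_real_rmult real_mult_shift real_lmult_lmult P real_lmult_one)
    then show ?thesis
      by transfer (simp add: real_mult_linear)
  qed
  ultimately show ?thesis
    by (simp add: F4_def Iso_R_def)
qed

section \<open>The real spectral theorem\<close>

text \<open>The quadratic form of \<open>A\<close> attains a maximum at some \<open>v\<close> on the unit sphere of the orthogonal
  complement of \<open>B\<close>. The vector \<open>w = A v - c v\<close>, with \<open>c\<close> the maximum, lies in that complement
  because \<open>B\<close> consists of eigenvectors, and it is orthogonal to \<open>v\<close>; if it did not vanish, moving \<open>v\<close>
  slightly towards \<open>w\<close> would increase the quotient of the form by the squared norm.\<close>

lemma symmetric_matrix_next_eigenvector:
  fixes A :: "real^'n^'n"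
  assumes sym: "transpose A = A"
    and B: "\<And>b. b \<in> B \<Longrightarrow> \<exists>c. A *v b = c *\<^sub>R b" and proper: "span B \<noteq> UNIV"
  shows "\<exists>v c. norm v = 1 \<and> (\<forall>b\<in>B. b \<bullet> v = 0) \<and> A *v v = c *\<^sub>R v"
proof -
  have A: "x \<bullet> (A *v y) = (A *v x) \<bullet> y" for x y
    by (metis dot_lmul_matrix sym transpose_matrix_vector)
  define S where "S = sphere 0 1 \<inter> (\<Inter>b\<in>B. {v. b \<bullet> v = 0})"
  have "compact S"
    unfolding S_def by (intro compact_Int_closed compact_sphere closed_INT ballI closed_hyperplane)
  moreover have "S \<noteq> {}"
  proof -
    have "span B \<subset> span UNIV" using proper by auto
    then obtain x where x: "x \<noteq> 0" "\<And>y. y \<in> span B \<Longrightarrow> orthogonal x y"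
      by (rule orthogonal_to_subspace_exists_gen) auto
    then have "x /\<^sub>R norm x \<in> S"
      by (auto simp: S_def orthogonal_def span_base inner_commute)
    then show ?thesis by blast
  qed
  moreover have "continuous_on S (\<lambda>x. x \<bullet> (A *v x))"
    by (intro continuous_intros linear_continuous_on matrix_vector_mul_bounded_linear)
  ultimately obtain v where v: "v \<in> S" and max: "\<And>x. x \<in> S \<Longrightarrow> x \<bullet> (A *v x) \<le> v \<bullet> (A *v v)"
    using continuous_attains_sup by metis
  define c where "c = v \<bullet> (A *v v)"
  have nv: "norm v = 1" "v \<bullet> v = 1" and vB: "\<And>b. b \<in> B \<Longrightarrow> b \<bullet> v = 0"
    using v by (auto simp: S_def norm_eq_1)
  have quad: "x \<bullet> (A *v x) \<le> c * (x \<bullet> x)" if x: "\<And>b. b \<in> B \<Longrightarrow> b \<bullet> x = 0" for x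
  proof (cases "x = 0")
    case False
    then have "x /\<^sub>R norm x \<in> S" using x by (auto simp: S_def)
    from max[OF this] have "(x \<bullet> (A *v x)) / (norm x)\<^sup>2 \<le> c"
      by (simp add: c_def matrix_vector_mult_scaleR power2_eq_square divide_simps)
    then show ?thesis using False by (simp add: field_simps power2_norm_eq_inner)
  qed simp
  define w where "w = A *v v - c *\<^sub>R v"
  have wv: "w \<bullet> v = 0"
    by (simp add: w_def c_def algebra_simps nv inner_commute)
  have wB: "b \<bullet> w = 0" if "b \<in> B" for b
  proof -
    from B[OF that] obtain d where "A *v b = d *\<^sub>R b" ..
    then have "b \<bullet> (A *v v) = 0" using vB[OF that] by (simp add: A)
    then show ?thesis by (simp add: w_def vB[OF that] inner_diff_right)
  qed
  have Av: "A *v v = w + c *\<^sub>R v" by (simp add: w_def)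
  have ww: "w \<bullet> (A *v v) = w \<bullet> w" "v \<bullet> (A *v w) = w \<bullet> w"
    using wv by (simp_all add: A Av inner_add_left inner_add_right inner_commute)
  have "2 * t * (w \<bullet> w) \<le> t\<^sup>2 * (c * (w \<bullet> w) - w \<bullet> (A *v w))" for t
  proof -
    have "(v + t *\<^sub>R w) \<bullet> (A *v (v + t *\<^sub>R w)) \<le> c * ((v + t *\<^sub>R w) \<bullet> (v + t *\<^sub>R w))"
      by (rule quad) (simp add: inner_add_right vB wB)
    then show ?thesis
      using wv ww nv by (simp add: matrix_vector_right_distrib matrix_vector_mult_scaleR inner_add_left
          inner_add_right c_def[symmetric] inner_commute[of v w] power2_eq_square algebra_simps)
  qed
  note ineq = this
  have "w = 0"
  proof (rule ccontr)
    assume "w \<noteq> 0"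
    then have pos: "w \<bullet> w > 0" by simp
    define \<beta> where "\<beta> = c * (w \<bullet> w) - w \<bullet> (A *v w)"
    \<comment> \<open>Small enough for the linear term to dominate the quadratic one.\<close>
    define t where "t = (w \<bullet> w) / (\<bar>\<beta>\<bar> + 1)"
    have t: "t > 0" using pos by (simp add: t_def add_nonneg_pos)
    have "2 * (w \<bullet> w) \<le> t * \<beta>"
      using ineq[of t] t by (simp add: \<beta>_def[symmetric] power2_eq_square)
    also have "\<dots> \<le> t * (\<bar>\<beta>\<bar> + 1)" using t by simp
    also have "\<dots> = w \<bullet> w" by (simp add: t_def)
    finally show False using pos by simp
  qed
  then show ?thesis
    using nv vB Av by auto
qed

lemma symmetric_matrix_orthonormal_eigenvectors:
  fixes A :: "real^'n^'n"
  assumes sym: "transpose A = A" and "k \<le> CARD('n)"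
  shows "\<exists>B. finite B \<and> card B = k \<and> pairwise orthogonal B \<and>
    (\<forall>b\<in>B. norm b = 1 \<and> (\<exists>c. A *v b = c *\<^sub>R b))"
  using \<open>k \<le> CARD('n)\<close>
proof (induction k)
  case 0
  show ?case by (intro exI[of _ "{}"]) simp
next
  case (Suc k)
  then obtain B where B: "finite B" "card B = k" "pairwise orthogonal B"
    "\<And>b. b \<in> B \<Longrightarrow> norm b = 1" "\<And>b. b \<in> B \<Longrightarrow> \<exists>c. A *v b = c *\<^sub>R b"
    by (meson Suc_leD)
  have "dim (span B) \<le> k" using B(1,2) dim_le_card'[of B] by simp
  then have "span B \<noteq> UNIV" using Suc.prems by (metis dim_UNIV DIM_cart DIM_real mult.right_neutral not_less_eq_eq)
  then obtain v c where v: "norm v = 1" "\<And>b. b \<in> B \<Longrightarrow> b \<bullet> v = 0" "A *v v = c *\<^sub>R v"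
    using symmetric_matrix_next_eigenvector[OF sym] B(5) by metis
  have "v \<notin> B" using v by (metis norm_eq_1 zero_neq_one)
  have "orthogonal v b" "orthogonal b v" if "b \<in> B" for b
    using v(2)[OF that] by (simp_all add: orthogonal_def inner_commute)
  then show ?case
    using B v \<open>v \<notin> B\<close> by (intro exI[of _ "insert v B"]) (auto simp: pairwise_insert)
qed

lemma symmetric_matrix_diagonalizable:
  fixes A :: "real^'n^'n"
  assumes sym: "transpose A = A"
  shows "\<exists>P. orthogonal_matrix P \<and> (\<forall>i j. i \<noteq> j \<longrightarrow> row i P \<bullet> (A *v row j P) = 0)"
proof -
  obtain B where B: "finite B" "card B = CARD('n)" "pairwise orthogonal B"
    "\<And>b. b \<in> B \<Longrightarrow> norm b = 1" "\<And>b. b \<in> B \<Longrightarrow> \<exists>c. A *v b = c *\<^sub>R b"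
    using symmetric_matrix_orthonormal_eigenvectors[OF sym order_refl] by metis
  obtain f where f: "bij_betw f (UNIV :: 'n set) B"
    using finite_same_card_bij[of "UNIV :: 'n set" B] B by auto
  then have fB: "f i \<in> B" for i by (auto simp: bij_betw_def)
  have orth: "f i \<bullet> f j = 0" if "i \<noteq> j" for i j
    using B(3) fB f that by (metis (no_types) bij_betw_def inj_eq orthogonal_def pairwiseD)
  let ?P = "\<chi> i. f i"
  have row: "row i ?P = f i" for i by (simp add: row_def vec_eq_iff)
  have "orthogonal_matrix ?P"
    unfolding orthogonal_matrix_orthonormal_rows by (auto simp: row B(4) fB orth orthogonal_def)
  moreover have "f i \<bullet> (A *v f j) = 0" if "i \<noteq> j" for i j
    using B(5)[OF fB[of j]] orth[OF that] by auto
  ultimately show ?thesis by (intro exI[of _ ?P]) (simp add: row)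
qed

section \<open>Diagonalization\<close>

definition diagonalizable :: "jordan3 \<Rightarrow> bool" where
  "diagonalizable X \<longleftrightarrow> (\<exists>\<alpha>\<in>F4. \<exists>a b c. \<alpha> X = herm a b c 0 0 0)"

lemma F4_comp:
  assumes "\<alpha> \<in> F4" "\<beta> \<in> F4"
  shows "\<alpha> \<circ> \<beta> \<in> F4"
  using assms by (auto simp: F4_def Iso_R_def intro: linear_compose bij_comp)

text \<open>Since \<open>F4\<close> is closed under composition, a matrix can be brought to diagonal form step by step.\<close>

lemma diagonalizable_F4:
  assumes "\<alpha> \<in> F4" "diagonalizable (\<alpha> X)"
  shows "diagonalizable X"
proof -
  obtain \<beta> a b c where \<beta>: "\<beta> \<in> F4" "\<beta> (\<alpha> X) = herm a b c 0 0 0"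
    using assms(2) by (auto simp: diagonalizable_def)
  then show ?thesis
    using F4_comp[OF \<beta>(1) assms(1)] unfolding diagonalizable_def by (intro bexI[of _ "\<beta> \<circ> \<alpha>"]) auto
qed

lemma exists_unit_multiple:
  assumes "u \<noteq> 0"
  obtains t where "oinner (t *\<^sub>R u) (t *\<^sub>R u) = 1"
proof
  have "oinner u u > 0"
    using assms oinner_self_nonneg[of u] oinner_eq_0_iff[of u] by linarith
  then show "oinner ((1 / sqrt (oinner u u)) *\<^sub>R u) ((1 / sqrt (oinner u u)) *\<^sub>R u) = 1"
    by (simp add: assms)
qed

text \<open>Such a matrix is a real symmetric matrix, and the real spectral theorem provides an orthogonal
  matrix whose conjugation makes it diagonal.\<close>

lemma diagonalizable_real:
  "diagonalizable (herm a b c (r *\<^sub>R 1) (s *\<^sub>R 1) (t *\<^sub>R 1))" (is "diagonalizable ?X")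
proof -
  define A :: "real^3^3" where
    "A = vector [vector [a, t, s], vector [t, b, r], vector [s, r, c]]"
  have X: "mat_of ?X $ i $ j = A $ i $ j *\<^sub>R 1" for i j
    using exhaust_3[of i] exhaust_3[of j] by (auto simp: herm.rep_eq A_def)
  have "transpose A = A"
    by (simp add: A_def transpose_def vec_eq_iff forall_3)
  from symmetric_matrix_diagonalizable[OF this]
  obtain P where P: "orthogonal_matrix P"
    "\<forall>i j. i \<noteq> j \<longrightarrow> row i P \<bullet> (A *v row j P) = 0"
    by (elim exE conjE)
  have "mat_of (real_conjugate P ?X) $ i $ j = (row i P \<bullet> (A *v row j P)) *\<^sub>R 1" for i j
    unfolding real_conjugate_entry X inner_vec_def matrix_vector_mult_def row_def
    by (simp add: sum_3 algebra_simps)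
  then have off: "mat_of (real_conjugate P ?X) $ i $ j = 0" if "i \<noteq> j" for i j
    using P(2) that by simp
  obtain a' b' c' x y z where h: "real_conjugate P ?X = herm a' b' c' x y z"
    by (rule herm_cases)
  have "x = 0" "y = 0" "z = 0"
    using off[of 2 3] off[of 3 1] off[of 1 2] by (simp_all add: h herm.rep_eq)
  with h show ?thesis
    unfolding diagonalizable_def using real_conjugate_in_F4[OF P(1)] by blast
qed

text \<open>With the third coordinate a real multiple of \<open>1\<close>, the action of one unit on the first position can
  be followed by the action of its conjugate on the second position, which restores the third
  coordinate. For an imaginary unit \<open>a\<close> the net effect on the first coordinate is left multiplication
  by \<open>a\<close>.\<close>

lemma diagonalizable_twist:
  assumes a: "oinner a a = 1" "o_re a = 0"
    and d: "diagonalizable (herm k l m (a * x) 0 (r *\<^sub>R 1))"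
  shows "diagonalizable (herm k l m x 0 (r *\<^sub>R 1))"
proof -
  have cnj: "ocnj a = - a" using a by (simp add: ocnj_eq)
  then have sq: "a * a = - 1"
    using ocnj_mult_self[of a] a by (simp add: minus_equation_iff[of "a * a"])
  have first: "triality (\<lambda>x. ocnj a * (x * ocnj a)) (\<lambda>x. a * x) (\<lambda>x. x * a)"
    using triality_unit[of "ocnj a"] a by simp
  have second: "triality (\<lambda>x. x * ocnj a) (\<lambda>x. a * (x * a)) (\<lambda>x. ocnj a * x)"
    by (rule triality_rotate, rule triality_rotate, rule triality_unit) (rule a)
  have "(a * (x * a)) * a = - (a * x)"
    using oct_right_alternative[of "a * x" a] by (simp add: oct_flexible sq)
  then have "diagonalizable (diagonal_action (\<lambda>x. x * ocnj a) (\<lambda>x. a * (x * a)) (\<lambda>x. ocnj a * x)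
      (diagonal_action (\<lambda>x. ocnj a * (x * ocnj a)) (\<lambda>x. a * x) (\<lambda>x. x * a)
        (herm k l m x 0 (r *\<^sub>R 1))))"
    using d by (simp add: cnj sq)
  then show ?thesis
    by (rule diagonalizable_F4[OF diagonal_action_in_F4[OF first] diagonalizable_F4[OF diagonal_action_in_F4[OF second]]])
qed

text \<open>The imaginary units \<open>i\<close> and \<open>j\<close> span a plane, which contains a direction orthogonal to \<open>x\<close>.\<close>

lemma exists_orthogonal_imaginary_unit:
  obtains a where "oinner a a = 1" "o_re a = 0" "o_re (a * x) = 0"
proof -
  define p q where "p = q_i (o_fst x)" and "q = q_j (o_fst x)"
  obtain u where u: "u \<noteq> 0" "o_re u = 0" "o_re (u * x) = 0"
  proof (cases "p = 0 \<and> q = 0")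
    case True
    show ?thesis
      by (rule that[of "Oct (Quat 0 1 0 0) 0"])
        (use True in \<open>simp_all add: p_def o_re_def oct_coords quat_coords\<close>)
  next
    case False
    show ?thesis
      by (rule that[of "Oct (Quat 0 q (- p) 0) 0"])
        (use False in \<open>auto simp: p_def q_def o_re_def oct_coords quat_coords\<close>)
  qed
  obtain t where "oinner (t *\<^sub>R u) (t *\<^sub>R u) = 1" by (rule exists_unit_multiple[OF u(1)])
  then show ?thesis
    using u(2,3) by (intro that[of "t *\<^sub>R u"]) simp_all
qed

text \<open>The twist by the normalized \<open>x\<close> itself makes the first coordinate real, as the square of an
  imaginary octonion is real.\<close>

lemma diagonalizable_imaginary:
  assumes "o_re x = 0"
  shows "diagonalizable (herm k l m x 0 (r *\<^sub>R 1))"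
proof (cases "x = 0")
  case True
  then show ?thesis using diagonalizable_real[of k l m 0 0 r] by simp
next
  case False
  then obtain t where t: "oinner (t *\<^sub>R x) (t *\<^sub>R x) = 1" by (rule exists_unit_multiple)
  have "ocnj x = - x" using assms by (simp add: ocnj_eq)
  then have "x * x = (- oinner x x) *\<^sub>R 1"
    using ocnj_mult_self[of x] by simp (metis minus_minus)
  then have "(t *\<^sub>R x) * x = (- (t * oinner x x)) *\<^sub>R 1" by simp
  then have d: "diagonalizable (herm k l m ((t *\<^sub>R x) * x) 0 (r *\<^sub>R 1))"
    using diagonalizable_real[of k l m "- (t * oinner x x)" 0 r] by simp
  show ?thesis
    by (rule diagonalizable_twist[OF t _ d]) (simp add: assms)
qed

text \<open>A twist by an imaginary unit orthogonal to \<open>x\<close> makes the first coordinate imaginary.\<close>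

lemma diagonalizable_real_corner: "diagonalizable (herm k l m x 0 (r *\<^sub>R 1))"
proof -
  obtain a where a: "oinner a a = 1" "o_re a = 0" "o_re (a * x) = 0"
    by (rule exists_orthogonal_imaginary_unit)
  then show ?thesis by (rule diagonalizable_twist[OF _ _ diagonalizable_imaginary])
qed

text \<open>The unit in the direction of \<open>z\<close> turns the third coordinate into a real number; the second one
  is only multiplied by a unit and stays \<open>0\<close>.\<close>

lemma diagonalizable_tridiagonal: "diagonalizable (herm k l m x 0 z)"
proof (cases "z = 0")
  case True
  then show ?thesis using diagonalizable_real_corner[of k l m x 0] by simp
next
  case False
  then obtain t where t: "oinner (t *\<^sub>R z) (t *\<^sub>R z) = 1" by (rule exists_unit_multiple)
  note T = diagonal_action_in_F4[OF triality_unit[OF t]]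
  have "z * ocnj z = oinner z z *\<^sub>R 1"
    using ocnj_mult_self[of "ocnj z"] by simp
  then show ?thesis
    by - (rule diagonalizable_F4[OF T], simp add: diagonalizable_real_corner)
qed

text \<open>For unit octonions \<open>p\<close> and \<open>q\<close> the equation \<open>p * ocnj u = q * u\<close> asks for a square root \<open>u\<close> of
  \<open>ocnj q * p\<close>, and a square root of a unit \<open>g\<close> other than \<open>- 1\<close> is the normalization of \<open>1 + g\<close>. The octonion \<open>v\<close> below
  is this sum, scaled so as to allow for arbitrary norms. If it
  vanishes, then \<open>p\<close> and \<open>q\<close> are parallel already.\<close>

lemma exists_unit_making_parallel:
  fixes p q :: octonion
  obtains u w r s where "oinner u u = 1" "p * ocnj u = r *\<^sub>R w" "q * u = s *\<^sub>R w"
proof -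
  define n m where "n = sqrt (oinner p p)" and "m = sqrt (oinner q q)"
  have n: "oinner p p = n * n" and m: "oinner q q = m * m"
    by (simp_all add: n_def m_def oinner_self_nonneg)
  define v where "v = (m * n) *\<^sub>R 1 + ocnj q * p"
  define w where "w = m *\<^sub>R p + n *\<^sub>R q"
  have pv: "p * ocnj v = n *\<^sub>R w"
    by (simp add: v_def w_def ocnj_mult oct_distrib mult_ocnj_cancel n algebra_simps)
  have qv: "q * v = m *\<^sub>R w"
    by (simp add: v_def w_def oct_distrib mult_ocnj_cancel m algebra_simps)
  show ?thesis
  proof (cases "v = 0")
    case False
    then obtain t where "oinner (t *\<^sub>R v) (t *\<^sub>R v) = 1" by (rule exists_unit_multiple)
    then show ?thesis
      using pv qv by (intro that[of "t *\<^sub>R v" "t * n" w "t * m"]) simp_all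
  next
    case True
    have one: "oinner 1 1 = 1" by (simp add: oinner_def)
    show ?thesis
    proof (cases "m = 0")
      case True
      then have "q = 0" using m by (metis mult_zero_left oinner_eq_0_iff)
      then show ?thesis by (intro that[of 1 1 p 0]) (simp_all add: one)
    next
      case False
      then have "w = 0" using qv \<open>v = 0\<close> by simp
      then have "m *\<^sub>R p = (- n) *\<^sub>R q" by (simp add: w_def add_eq_0_iff2)
      then have "p = (- n / m) *\<^sub>R q" using False by (metis (no_types, lifting) divide_inverse_commute scaleR_scaleR scaleR_one left_inverse)
      then show ?thesis by (intro that[of 1 "- n / m" q 1]) (simp_all add: one)
    qed
  qed
qed

text \<open>The real vector \<open>(r, s)\<close> of coefficients along \<open>w\<close> can be turned into a multiple of \<open>(1, 0)\<close> by an
  orthogonal transformation of the last two indices, which is what removes the second coordinate.\<close>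

lemma diagonalizable_parallel:
  assumes z: "z = r *\<^sub>R w" and y: "ocnj y = s *\<^sub>R w"
  shows "diagonalizable (herm k l m x y z)"
proof (cases "r = 0 \<and> s = 0")
  case True
  then have "y = 0" using y by (metis ocnj_linear(1) ocnj_simps(1) scaleR_zero_left)
  then show ?thesis by (simp add: diagonalizable_tridiagonal)
next
  case False
  define d e f where "d = sqrt (r\<^sup>2 + s\<^sup>2)" and "e = s / d" and "f = - r / d"
  have d: "d\<^sup>2 = r\<^sup>2 + s\<^sup>2" "d \<noteq> 0"
    using False by (auto simp: d_def add_nonneg_eq_0_iff)
  have ef: "e * e + f * f = 1"
  proof -
    have "e * e + f * f = (r\<^sup>2 + s\<^sup>2) / d\<^sup>2"
      by (simp add: e_def f_def power2_eq_square add_divide_distrib)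
    then show ?thesis using False by (simp add: d(1))
  qed
  have efrs: "e * r + f * s = 0" by (simp add: e_def f_def)
  \<comment> \<open>The last row is orthogonal to the coefficients \<open>(r, s)\<close> of the entries \<open>(1, 2)\<close> and \<open>(1, 3)\<close>.\<close>
  define P :: "real^3^3" where
    "P = vector [vector [1, 0, 0], vector [0, - f, e], vector [0, e, f]]"
  have "orthogonal_matrix P"
    using ef by (simp add: P_def orthogonal_matrix matrix_matrix_mult_def transpose_def mat_def
        vec_eq_iff forall_3 sum_3 add.commute)
  note P = real_conjugate_in_F4[OF this]
  let ?Y = "real_conjugate P (herm k l m x y z)"
  have "mat_of ?Y $ 1 $ 3 = e *\<^sub>R z + f *\<^sub>R ocnj y"
    by (simp add: real_conjugate_entry sum_3 herm.rep_eq P_def)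
  also have "\<dots> = 0"
    using efrs by (simp add: z y flip: scaleR_add_left)
  finally have "mat_of ?Y $ 1 $ 3 = 0" .
  moreover obtain a b c x' y' z' where h: "?Y = herm a b c x' y' z'" by (rule herm_cases)
  ultimately have "ocnj y' = 0" by (simp add: herm.rep_eq)
  then have "y' = 0" by (metis ocnj_linear(1) ocnj_simps(1))
  then have "diagonalizable ?Y"
    by (simp add: h diagonalizable_tridiagonal)
  then show ?thesis
    by (rule diagonalizable_F4[OF P])
qed

lemma all_diagonalizable: "diagonalizable X"
proof -
  obtain k l m x y z where X: "X = herm k l m x y z" by (rule herm_cases)
  obtain u w r s where u: "oinner u u = 1" "z * ocnj u = r *\<^sub>R w" "ocnj y * u = s *\<^sub>R w"
    by (rule exists_unit_making_parallel)
  note T = diagonal_action_in_F4[OF triality_unit[OF u(1)]]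
  show ?thesis
    unfolding X using u
    by - (rule diagonalizable_F4[OF T], simp add: ocnj_mult diagonalizable_parallel[of _ r w _ s])
qed

theorem theorem1:
  fixes X :: jordan3
  shows "\<exists>\<alpha>\<in>F4. \<exists>\<xi>\<^sub>1 \<xi>\<^sub>2 \<xi>\<^sub>3 :: real.
    mat_of (\<alpha> X) =
      vector [vector [\<xi>\<^sub>1 *\<^sub>R 1, 0, 0],
              vector [0, \<xi>\<^sub>2 *\<^sub>R 1, 0],
              vector [0, 0, \<xi>\<^sub>3 *\<^sub>R 1]]"
proof -
  obtain \<alpha> a b c where "\<alpha> \<in> F4" "\<alpha> X = herm a b c 0 0 0"
    using all_diagonalizable[of X] by (auto simp: diagonalizable_def)
  then show ?thesis
    by (intro bexI[of _ \<alpha>] exI[of _ a] exI[of _ b] exI[of _ c]) (simp_all add: herm.rep_eq)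
qed

end
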